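(* Let $\Sigma=\{\mathtt{a},\mathtt{b}\}$ and let $[W]=[(w_\varepsilon)]\in\widetilde{\Sigma}^*$ be the class of the oscillating net $$w_\varepsilon=\begin{cases}(\mathtt{a}\mathtt{b})^{\lfloor\varepsilon^{-1}\rfloor}&\text{if }\lfloor\log_2(1/\varepsilon)\rfloor\text{ is even},\\(\mathtt{b}\mathtt{a})^{\lfloor\varepsilon^{-1}\rfloor}&\text{if }\lfloor\log_2(1/\varepsilon)\rfloor\text{ is odd}.\end{cases}$$ Then, with respect to the truncation map $\iota^\infty:\Sigma^\infty\to\widetilde{\Sigma}^*$: (i) $[W]\notin\iota^\infty(\Sigma^* )$; (ii) $[W]\notin\iota^\infty(\Sigma^\omega)$.
   Context: $\Sigma^*$ is the free monoid of finite words over $\Sigma$ under concatenation, $\lambda$ is the empty word, $|w|$ is the length of $w$; $\Sigma^\omega$ is the set of right-infinite words $u=u_1u_2\cdots$ and $\Sigma^\infty=\Sigma^*\cup\Sigma^\omega$. For $u\neq v$ in $\Sigma^*$, $\operatorname{lcp}(u,v)$ and $\operatorname{lcs}(u,v)$ are the lengths of the longest common prefix and of the longest common suffix of $u,v$; by convention $\operatorname{lcp}(u,u)=\operatorname{lcs}(u,u)=+\infty$. A net of words is a family $(w_\varepsilon)_{\varepsilon\in(0,1]}$ of words in $\Sigma^*$. It is moderate if there exist $N\in\mathbb{N}$, $C>0$, $\varepsilon_0>0$ with $|w_\varepsilon|\le C\varepsilon^{-N}$ for all $\varepsilon<\varepsilon_0$. $\mathcal{E}_M(\Sigma^* )$ is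 the set of moderate nets. Two moderate nets are equivalent, $(u_\varepsilon)\sim(v_\varepsilon)$, if for every $m\in\mathbb{N}$ there exists $\varepsilon_0>0$ such that $\min\{\operatorname{lcp}(u_\varepsilon,v_\varepsilon),\operatorname{lcs}(u_\varepsilon,v_\varepsilon)\}\ge m\log_2(1/\varepsilon)$ for all $\varepsilon<\varepsilon_0$; this is an equivalence relation. $\widetilde{\Sigma}^*:=\mathcal{E}_M(\Sigma^* )/\sim$, with classes written $[(w_\varepsilon)]$. The truncation map $\iota^\infty:\Sigma^\infty\to\widetilde{\Sigma}^*$ is defined by: $\iota^\infty(u)=[(u)_\varepsilon]$ (class of the constant net) for $u\in\Sigma^*$, and $\iota^\infty(u)=[(u_1u_2\cdots u_{\lfloor 1/\varepsilon\rfloor})_\varepsilon]$ for $u=u_1u_2\cdots\in\Sigma^\omega$. *)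

theory Defs
  imports
    Complex_Main
    "HOL-Library.Sublist"
    "HOL-Library.Stream"
    "HOL-Library.FuncSet"
    "HOL-Library.Extended_Real"
begin

text \<open>
  The alphabet is a type \<open>'a\<close>, so that \<open>'a list\<close> is the free monoid of finite words and
  \<open>'a stream\<close> the set of right-infinite words.
\<close>

datatype 'a fin_or_inf_word = Fin_word "'a list" | Inf_word "'a stream"

definition lcp :: "'a list \<Rightarrow> 'a list \<Rightarrow> enat" where
  "lcp u v = (if u = v then \<infinity> else enat (length (longest_common_prefix u v)))"

text \<open>The longest common suffix of two words is the reversal of the longest common prefix of
  the reversed words (see \<open>lcs_suffix\<close> and \<open>lcs_max_suffix\<close> below).\<close>

definition longest_common_suffix :: "'a list \<Rightarrow> 'a list \<Rightarrow> 'a list" where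
  "longest_common_suffix u v = rev (longest_common_prefix (rev u) (rev v))"

definition lcs :: "'a list \<Rightarrow> 'a list \<Rightarrow> enat" where
  "lcs u v = (if u = v then \<infinity> else enat (length (longest_common_suffix u v)))"

lemma lcs_suffix:
  "suffix (longest_common_suffix u v) u" "suffix (longest_common_suffix u v) v"
  by (simp_all add: longest_common_suffix_def suffix_to_prefix
      longest_common_prefix_prefix1 longest_common_prefix_prefix2)

lemma lcs_max_suffix:
  assumes "suffix s u" "suffix s v"
  shows "suffix s (longest_common_suffix u v)"
  using assms
  by (simp add: longest_common_suffix_def suffix_to_prefix longest_common_prefix_max_prefix)

text \<open>A family indexed by the interval \<open>(0,1]\<close> is an extensional function on that interval.\<close>

definition nets :: "(real \<Rightarrow> 'a list) set" where
  "nets = {0<..1} \<rightarrow>\<^sub>E UNIV"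

definition moderate_nets :: "(real \<Rightarrow> 'a list) set" where
  "moderate_nets = {w \<in> nets. \<exists>(N::nat) C \<epsilon>\<^sub>0. C > 0 \<and> \<epsilon>\<^sub>0 > 0 \<and>
     (\<forall>\<epsilon>\<in>{0<..1}. \<epsilon> < \<epsilon>\<^sub>0 \<longrightarrow> real (length (w \<epsilon>)) \<le> C * \<epsilon> powr (- real N))}"

definition net_equiv :: "((real \<Rightarrow> 'a list) \<times> (real \<Rightarrow> 'a list)) set" where
  "net_equiv = {(u, v). u \<in> moderate_nets \<and> v \<in> moderate_nets \<and>
     (\<forall>m::nat. \<exists>\<epsilon>\<^sub>0>0. \<forall>\<epsilon>\<in>{0<..1}. \<epsilon> < \<epsilon>\<^sub>0 \<longrightarrow>
        ereal_of_enat (min (lcp (u \<epsilon>) (v \<epsilon>)) (lcs (u \<epsilon>) (v \<epsilon>)))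
          \<ge> ereal (real m * log 2 (1 / \<epsilon>)))}"

definition generalized_words :: "(real \<Rightarrow> 'a list) set set" where
  "generalized_words = moderate_nets // net_equiv"

definition net_class :: "(real \<Rightarrow> 'a list) \<Rightarrow> (real \<Rightarrow> 'a list) set" where
  "net_class w = net_equiv `` {w}"

text \<open>The library's \<open>stake n u\<close> is the prefix of length \<open>n\<close> of the infinite word \<open>u\<close>.\<close>

primrec truncation_net :: "'a fin_or_inf_word \<Rightarrow> real \<Rightarrow> 'a list" where
  "truncation_net (Fin_word u) = (\<lambda>\<epsilon>\<in>{0<..1}. u)"
| "truncation_net (Inf_word u) = (\<lambda>\<epsilon>\<in>{0<..1}. stake (nat \<lfloor>1 / \<epsilon>\<rfloor>) u)"

definition truncation_map :: "'a fin_or_inf_word \<Rightarrow> (real \<Rightarrow> 'a list) set" where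
  "truncation_map u = net_class (truncation_net u)"

datatype letter = Letter_a | Letter_b

definition oscillating_net :: "real \<Rightarrow> letter list" where
  "oscillating_net = (\<lambda>\<epsilon>\<in>{0<..1}.
     if even \<lfloor>log 2 (1 / \<epsilon>)\<rfloor>
     then concat (replicate (nat \<lfloor>1 / \<epsilon>\<rfloor>) [Letter_a, Letter_b])
     else concat (replicate (nat \<lfloor>1 / \<epsilon>\<rfloor>) [Letter_b, Letter_a]))"


lemma longest_common_prefix_commute:
  "longest_common_prefix u v = longest_common_prefix v u"
  by (induction u v rule: longest_common_prefix.induct) auto

lemma lcp_commute: "lcp u v = lcp v u"
  by (simp add: lcp_def longest_common_prefix_commute)

lemma lcs_eq_lcp_rev: "lcs u v = lcp (rev u) (rev v)"
  by (simp add: lcp_def lcs_def longest_common_suffix_def)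

lemma lcs_commute: "lcs u v = lcs v u"
  by (simp add: lcs_eq_lcp_rev lcp_commute)

lemma lcp_ultrametric: "min (lcp u v) (lcp v w) \<le> lcp u w"
proof (cases "u = v \<or> v = w \<or> u = w")
  case True
  then show ?thesis by (auto simp: lcp_def)
next
  case False
  let ?p = "longest_common_prefix u v" and ?q = "longest_common_prefix v w"
  have p: "prefix ?p u" "prefix ?p v" and q: "prefix ?q v" "prefix ?q w"
    by (simp_all add: longest_common_prefix_prefix1 longest_common_prefix_prefix2)
  from p(2) q(1) consider "prefix ?p ?q" | "prefix ?q ?p"
    using prefix_same_cases by blast
  then show ?thesis
  proof cases
    case 1
    then have "prefix ?p (longest_common_prefix u w)"
      using p q by (meson longest_common_prefix_max_prefix prefix_order.trans)
    then show ?thesis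
      using False by (auto simp: lcp_def min_def dest: prefix_length_le)
  next
    case 2
    then have "prefix ?q (longest_common_prefix u w)"
      using p q by (meson longest_common_prefix_max_prefix prefix_order.trans)
    then show ?thesis
      using False by (auto simp: lcp_def min_def dest: prefix_length_le)
  qed
qed

lemma lcs_ultrametric: "min (lcs u v) (lcs v w) \<le> lcs u w"
  by (simp add: lcs_eq_lcp_rev lcp_ultrametric)

lemma equiv_net_equiv: "equiv (moderate_nets :: (real \<Rightarrow> 'a list) set) net_equiv"
proof (rule equivI)
  show "net_equiv \<subseteq> moderate_nets \<times> moderate_nets"
    by (auto simp: net_equiv_def)
  show "refl_on moderate_nets net_equiv"
    by (auto simp: refl_on_def net_equiv_def lcp_def lcs_def intro: exI[of _ 1])
  show "sym net_equiv"
    by (auto simp: sym_def net_equiv_def lcp_commute lcs_commute)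
  show "trans (net_equiv :: ((real \<Rightarrow> 'a list) \<times> _) set)"
  proof (rule transI)
    fix u v w :: "real \<Rightarrow> 'a list"
    assume uv: "(u, v) \<in> net_equiv" and vw: "(v, w) \<in> net_equiv"
    have "\<exists>\<epsilon>\<^sub>0>0. \<forall>\<epsilon>\<in>{0<..1}. \<epsilon> < \<epsilon>\<^sub>0 \<longrightarrow>
        ereal_of_enat (min (lcp (u \<epsilon>) (w \<epsilon>)) (lcs (u \<epsilon>) (w \<epsilon>)))
          \<ge> ereal (real m * log 2 (1 / \<epsilon>))" for m :: nat
    proof -
      obtain d where d: "d > 0" "\<And>\<epsilon>. \<epsilon>\<in>{0<..1} \<Longrightarrow> \<epsilon> < d \<Longrightarrow>
        ereal_of_enat (min (lcp (u \<epsilon>) (v \<epsilon>)) (lcs (u \<epsilon>) (v \<epsilon>)))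
          \<ge> ereal (real m * log 2 (1 / \<epsilon>))"
        using uv unfolding net_equiv_def by blast
      obtain e where e: "e > 0" "\<And>\<epsilon>. \<epsilon>\<in>{0<..1} \<Longrightarrow> \<epsilon> < e \<Longrightarrow>
        ereal_of_enat (min (lcp (v \<epsilon>) (w \<epsilon>)) (lcs (v \<epsilon>) (w \<epsilon>)))
          \<ge> ereal (real m * log 2 (1 / \<epsilon>))"
        using vw unfolding net_equiv_def by blast
      have "ereal (real m * log 2 (1 / \<epsilon>))
          \<le> ereal_of_enat (min (lcp (u \<epsilon>) (w \<epsilon>)) (lcs (u \<epsilon>) (w \<epsilon>)))"
        if \<epsilon>: "\<epsilon> \<in> {0<..1}" "\<epsilon> < min d e" for \<epsilon>
      proof -
        let ?x = "min (lcp (u \<epsilon>) (v \<epsilon>)) (lcs (u \<epsilon>) (v \<epsilon>))"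
        let ?y = "min (lcp (v \<epsilon>) (w \<epsilon>)) (lcs (v \<epsilon>) (w \<epsilon>))"
        have "min ?x ?y \<le> min (lcp (u \<epsilon>) (w \<epsilon>)) (lcs (u \<epsilon>) (w \<epsilon>))"
          using lcp_ultrametric[of "u \<epsilon>" "v \<epsilon>" "w \<epsilon>"] lcs_ultrametric[of "u \<epsilon>" "v \<epsilon>" "w \<epsilon>"]
          by (auto simp: min_le_iff_disj)
        then have "ereal_of_enat (min ?x ?y)
            \<le> ereal_of_enat (min (lcp (u \<epsilon>) (w \<epsilon>)) (lcs (u \<epsilon>) (w \<epsilon>)))"
          by simp
        moreover have "ereal (real m * log 2 (1 / \<epsilon>)) \<le> ereal_of_enat (min ?x ?y)"
          using d(2)[of \<epsilon>] e(2)[of \<epsilon>] \<epsilon> by (simp add: min_def split: if_splits)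
        ultimately show ?thesis by (blast intro: order_trans)
      qed
      then show ?thesis using d(1) e(1) by (intro exI[of _ "min d e"]) auto
    qed
    then show "(u, w) \<in> net_equiv"
      using uv vw by (auto simp: net_equiv_def)
  qed
qed

lemma net_class_in_generalized_words:
  "w \<in> moderate_nets \<Longrightarrow> net_class w \<in> generalized_words"
  by (simp add: net_class_def generalized_words_def quotientI)

lemma truncation_net_moderate: "truncation_net u \<in> moderate_nets"
proof (cases u)
  case (Fin_word x)
  have "real (length (truncation_net u \<epsilon>)) \<le> (real (length x) + 1) * \<epsilon> powr (- real 0)"
    if "\<epsilon> \<in> {0<..1}" for \<epsilon>
    using that by (simp add: Fin_word)
  moreover have "truncation_net u \<in> nets"
    by (auto simp: Fin_word nets_def)
  moreover have "real (length x) + 1 > 0" by simp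
  ultimately show ?thesis
    unfolding moderate_nets_def by (blast intro: zero_less_one)
next
  case (Inf_word x)
  have "real (length (truncation_net u \<epsilon>)) \<le> 1 * \<epsilon> powr (- real 1)" if "\<epsilon> \<in> {0<..1}" for \<epsilon>
    using that of_int_floor_le[of "1 / \<epsilon>"] by (simp add: Inf_word powr_minus_divide)
  moreover have "truncation_net u \<in> nets"
    by (auto simp: Inf_word nets_def)
  ultimately show ?thesis
    unfolding moderate_nets_def by (blast intro: zero_less_one)
qed

lemma truncation_map_in_generalized_words: "truncation_map u \<in> generalized_words"
  by (simp add: truncation_map_def net_class_in_generalized_words truncation_net_moderate)

lemma oscillating_net_moderate: "oscillating_net \<in> moderate_nets"
proof -
  have "real (length (oscillating_net \<epsilon>)) \<le> 2 * \<epsilon> powr (- real 1)" if "\<epsilon> \<in> {0<..1}" for \<epsilon>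
    using that mult_left_mono[OF of_int_floor_le[of "1 / \<epsilon>"], of 2]
    by (simp add: oscillating_net_def powr_minus_divide length_concat sum_list_replicate)
  moreover have "oscillating_net \<in> nets"
    by (auto simp: oscillating_net_def nets_def)
  ultimately show ?thesis
    unfolding moderate_nets_def by (blast intro: zero_less_one zero_less_numeral)
qed

lemma oscillating_class_in_generalized_words:
  "net_class oscillating_net \<in> generalized_words"
  by (simp add: net_class_in_generalized_words oscillating_net_moderate)

end

theory Submission
  imports Defs
begin

text \<open>
  Both parts hold for the same reason: equivalence of nets preserves the eventual first letter.
  The common prefix of two equivalent nets grows at least like \<open>log\<^sub>2 (1/\<epsilon>)\<close>, so their words
  eventually share every prefix of fixed length (\<open>net_equiv_eventually_same_prefix\<close>). A truncation
  net, whether of a finite or of an infinite word, eventually has a constant prefix of each fixed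
  length (\<open>truncation_net_prefix_constant\<close>); for length one this covers the empty word too, whose
  ``first letter'' is constantly absent. The oscillating net, however, starts with \<open>a\<close> at
  \<open>\<epsilon> = 2\<^sup>-\<^sup>k\<close> for even \<open>k\<close> and with \<open>b\<close> for odd \<open>k\<close>, so its first letter changes between \<open>2\<^sup>-\<^sup>k\<close> and
  \<open>2\<^sup>-\<^sup>k\<^sup>-\<^sup>1\<close> arbitrarily close to \<open>0\<close>.
\<close>

lemma take_eq_if_le_lcp:
  assumes "enat n \<le> lcp u v"
  shows "take n u = take n v"
proof (cases "u = v")
  case False
  let ?p = "longest_common_prefix u v"
  have "n \<le> length ?p"
    using assms False by (simp add: lcp_def)
  then have "take n w = take n ?p" if "prefix ?p w" for w
    using that by (elim prefixE) (metis diff_is_0_eq take_0 take_append append_Nil2)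
  then show ?thesis
    using longest_common_prefix_prefix1 longest_common_prefix_prefix2 by metis
qed simp

text \<open>
  The growth condition with \<open>m = 1\<close> is enough: \<open>log\<^sub>2 (1/\<epsilon>)\<close> exceeds \<open>n\<close> once \<open>\<epsilon> < 2\<^sup>-\<^sup>n\<close>.
\<close>

lemma net_equiv_eventually_same_prefix:
  assumes "(u, v) \<in> net_equiv"
  obtains \<epsilon>\<^sub>0 where "\<epsilon>\<^sub>0 > 0"
    "\<And>\<epsilon>. \<epsilon> \<in> {0<..1} \<Longrightarrow> \<epsilon> < \<epsilon>\<^sub>0 \<Longrightarrow> take n (u \<epsilon>) = take n (v \<epsilon>)"
proof -
  have "\<exists>\<delta>>0. \<forall>\<epsilon>\<in>{0<..1}. \<epsilon> < \<delta> \<longrightarrow>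
      ereal_of_enat (min (lcp (u \<epsilon>) (v \<epsilon>)) (lcs (u \<epsilon>) (v \<epsilon>))) \<ge> ereal (real 1 * log 2 (1 / \<epsilon>))"
    using assms unfolding net_equiv_def by blast
  then obtain \<delta> where \<delta>: "\<delta> > 0" and le: "\<And>\<epsilon>. \<epsilon> \<in> {0<..1} \<Longrightarrow> \<epsilon> < \<delta> \<Longrightarrow>
      ereal (log 2 (1 / \<epsilon>)) \<le> ereal_of_enat (min (lcp (u \<epsilon>) (v \<epsilon>)) (lcs (u \<epsilon>) (v \<epsilon>)))"
    by auto
  have "take n (u \<epsilon>) = take n (v \<epsilon>)" if \<epsilon>: "\<epsilon> \<in> {0<..1}" "\<epsilon> < min \<delta> (1 / 2 ^ n)" for \<epsilon>
  proof -
    have "2 ^ n \<le> 1 / \<epsilon>"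
      using \<epsilon> by (simp add: field_simps)
    then have "real n \<le> log 2 (1 / \<epsilon>)"
      using \<epsilon> by (simp add: le_log_iff powr_realpow)
    then have "ereal (real n) \<le> ereal (log 2 (1 / \<epsilon>))"
      by simp
    also have "\<dots> \<le> ereal_of_enat (min (lcp (u \<epsilon>) (v \<epsilon>)) (lcs (u \<epsilon>) (v \<epsilon>)))"
      using le \<epsilon> by simp
    finally have "ereal_of_enat (enat n)
        \<le> ereal_of_enat (min (lcp (u \<epsilon>) (v \<epsilon>)) (lcs (u \<epsilon>) (v \<epsilon>)))"
      by simp
    then have "enat n \<le> lcp (u \<epsilon>) (v \<epsilon>)"
      by (simp only: ereal_of_enat_le_iff min.bounded_iff)
    then show ?thesis
      by (rule take_eq_if_le_lcp)
  qed
  with \<delta> show thesis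
    by (intro that[of "min \<delta> (1 / 2 ^ n)"]) auto
qed

text \<open>
  The bound \<open>n \<le> 1/\<epsilon>\<close> makes the truncation of an infinite word at least \<open>n\<close> letters long. A finite
  word shorter than \<open>n\<close> is its own constant prefix, so \<open>p\<close> need not have length \<open>n\<close>.
\<close>

lemma truncation_net_prefix_constant:
  obtains p where
    "\<And>\<epsilon>. \<epsilon> \<in> {0<..1} \<Longrightarrow> real n \<le> 1 / \<epsilon> \<Longrightarrow> take n (truncation_net x \<epsilon>) = p"
proof (cases x)
  case (Fin_word u)
  then show thesis
    by (intro that[of "take n u"]) simp
next
  case (Inf_word s)
  have "take n (truncation_net x \<epsilon>) = stake n s"
    if "\<epsilon> \<in> {0<..1}" "real n \<le> 1 / \<epsilon>" for \<epsilon>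
  proof -
    have "n \<le> nat \<lfloor>1 / \<epsilon>\<rfloor>"
      using that by (simp add: le_nat_floor)
    then show ?thesis
      using that Inf_word by (simp add: take_stake min_def)
  qed
  then show thesis
    by (rule that)
qed

lemma oscillating_net_first_letter:
  "take 1 (oscillating_net (1 / 2 ^ k)) = [if even k then Letter_a else Letter_b]"
proof -
  have "\<lfloor>log 2 (1 / (1 / 2 ^ k))\<rfloor> = int k"
    by (simp add: log_nat_power)
  moreover have "nat \<lfloor>1 / (1 / 2 ^ k :: real)\<rfloor> = 2 ^ k"
    by (simp add: nat_power_eq)
  moreover obtain m where "2 ^ k = Suc m"
    using gr0_implies_Suc[of "2 ^ k"] by auto
  ultimately show ?thesis
    by (simp add: oscillating_net_def)
qed

lemma oscillating_class_not_truncation: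
  "net_class oscillating_net \<noteq> truncation_map x"
proof
  assume "net_class oscillating_net = truncation_map x"
  then have "(oscillating_net, truncation_net x) \<in> net_equiv"
    unfolding truncation_map_def net_class_def
    using equiv_net_equiv truncation_net_moderate by (rule eq_equiv_class)
  then obtain \<epsilon>\<^sub>0 where \<epsilon>\<^sub>0: "\<epsilon>\<^sub>0 > 0" and same: "\<And>\<epsilon>. \<epsilon> \<in> {0<..1} \<Longrightarrow> \<epsilon> < \<epsilon>\<^sub>0 \<Longrightarrow>
      take 1 (oscillating_net \<epsilon>) = take 1 (truncation_net x \<epsilon>)"
    by (rule net_equiv_eventually_same_prefix[where n = 1]) blast
  obtain p where const: "\<And>\<epsilon>. \<epsilon> \<in> {0<..1} \<Longrightarrow> real 1 \<le> 1 / \<epsilon> \<Longrightarrow>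
      take 1 (truncation_net x \<epsilon>) = p"
    by (rule truncation_net_prefix_constant[where n = 1 and x = x]) blast
  have p: "[if even j then Letter_a else Letter_b] = p" if "1 / 2 ^ j < \<epsilon>\<^sub>0" for j :: nat
  proof -
    have "1 / 2 ^ j \<in> {0<..1::real}"
      by simp
    with that same[of "1 / 2 ^ j"] const[of "1 / 2 ^ j"] show ?thesis
      by (simp only: oscillating_net_first_letter) simp
  qed
  \<comment> \<open>Two consecutive exponents have different parities, hence contradictory values of \<open>p\<close>.\<close>
  obtain k where k: "1 / 2 ^ k < \<epsilon>\<^sub>0"
    using real_arch_pow_inv[OF \<epsilon>\<^sub>0, of "1/2"] by (auto simp: power_one_over)
  have "1 / 2 ^ Suc k \<le> (1 / 2 ^ k :: real)"
    by (simp add: field_simps)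
  with k have k': "1 / 2 ^ Suc k < \<epsilon>\<^sub>0"
    by linarith
  from p[OF k] p[OF k'] show False
    by (auto split: if_splits)
qed

theorem theorem4p3:
  shows "net_class oscillating_net \<notin> truncation_map ` range Fin_word
    \<and> net_class oscillating_net \<notin> truncation_map ` range Inf_word"
  using oscillating_class_not_truncation by blast

end
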